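(* Let $H_1,H_2$ be Hilbert spaces and let $\mathcal{A}\subset B(H_1)$, $\mathcal{B}\subset B(H_2)$ be $w^*$-closed algebras. If $\mathcal{A}$ and $\mathcal{B}$ are TRO equivalent, then they are spatially Morita equivalent.
   Context: For sets of operators, $\mathcal{X}^*=\{X^*:X\in\mathcal{X}\}$, $\mathcal{X}\mathcal{Y}=\{XY: X\in\mathcal{X},Y\in\mathcal{Y}\}$, and $\mathrm{span}(\mathcal{X})^{-w^*}$ is the weak-$*$ closure of the linear span. An algebra is a subalgebra (not necessarily selfadjoint or unital) of $B(H)$ for some Hilbert space $H$. A ternary ring of operators (TRO) is a linear subspace $\mathcal{M}\subset B(H_1,H_2)$ with $\mathcal{M}\mathcal{M}^*\mathcal{M}\subset\mathcal{M}$. Two $w^*$-closed algebras $\mathcal{A}\subset B(H_1)$, $\mathcal{B}\subset B(H_2)$ are TRO equivalent if there is a TRO $\mathcal{M}\subset B(H_1,H_2)$ with $\mathcal{A}=\mathrm{span}(\mathcal{M}^*\mathcal{B}\mathcal{M})^{-w^*}$ and $\mathcal{B}=\mathrm{span}(\mathcal{M}\mathcal{A}\mathcal{M}^* )^{-w^*}$. They are spatially Morita equivalent if there exist linear spaces $\mathcal{U}\subset B(H_1,H_2)$ and $\mathcal{V}\subset B(H_2,H_1)$ such that $\mathcal{B}\mathcal{U}\mathcal{A}\subset\mathcal{U}$, $\mathcal{A}\mathcal{V}\mathcal{B}\subset\mathcal{V}$, $\mathrm{span}(\mathcal{V}\mathcal{U})^{-w^*}=\mathcal{A}$ and $\mathrm{span}(\mathcal{U}\mathcal{V})^{-w^*}=\mathcal{B}$.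 *)

theory Defs
  imports "HOL-Analysis.Analysis"
begin

section \<open>Complex Hilbert spaces\<close>

class complex_vector = real_vector +
  fixes scaleC :: "complex \<Rightarrow> 'a \<Rightarrow> 'a" (infixr \<open>*\<^sub>C\<close> 75)
  assumes scaleC_add_right: "c *\<^sub>C (x + y) = c *\<^sub>C x + c *\<^sub>C y"
    and scaleC_add_left: "(c + d) *\<^sub>C x = c *\<^sub>C x + d *\<^sub>C x"
    and scaleC_scaleC: "c *\<^sub>C d *\<^sub>C x = (c * d) *\<^sub>C x"
    and scaleC_of_real: "complex_of_real r *\<^sub>C x = r *\<^sub>R x"

global_interpretation complex_vector: vector_space "scaleC :: complex \<Rightarrow> 'a \<Rightarrow> 'a::complex_vector"
  defines csubspace = complex_vector.subspace
    and cspan = complex_vector.span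
proof
  fix c d :: complex and x y :: 'a
  show "c *\<^sub>C (x + y) = c *\<^sub>C x + c *\<^sub>C y" by (rule scaleC_add_right)
  show "(c + d) *\<^sub>C x = c *\<^sub>C x + d *\<^sub>C x" by (rule scaleC_add_left)
  show "c *\<^sub>C d *\<^sub>C x = (c * d) *\<^sub>C x" by (rule scaleC_scaleC)
  show "1 *\<^sub>C x = x" using scaleC_of_real[of 1 x] by simp
qed

text \<open>The scalar product is linear in the first variable. Its real part is the library's
  real inner product, so norm and topology are those of the underlying real space; positive
  definiteness is inherited from \<^class>\<open>real_inner\<close>.\<close>

class complex_inner = complex_vector + real_inner +
  fixes cinner :: "'a \<Rightarrow> 'a \<Rightarrow> complex"
  assumes cinner_commute: "cinner x y = cnj (cinner y x)"
    and cinner_add_left: "cinner (x + y) z = cinner x z + cinner y z"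
    and cinner_scaleC_left: "cinner (c *\<^sub>C x) y = c * cinner x y"
    and Re_cinner: "Re (cinner x y) = x \<bullet> y"

class complex_hilbert = complex_inner + complete_space

instantiation complex :: complex_hilbert
begin

definition "c *\<^sub>C (z::complex) = c * z"

definition "cinner (z::complex) w = z * cnj w"

instance
  by standard (auto simp: scaleC_complex_def cinner_complex_def algebra_simps scaleR_conv_of_real
      inner_complex_def)

end


section \<open>Bounded operators\<close>

text \<open>The type \<open>('a, 'b) bop\<close> is the space of bounded complex-linear operators from
  \<open>'a\<close> to \<open>'b\<close>.\<close>

typedef (overloaded) ('a, 'b) bop =
  "{f :: 'a::complex_inner \<Rightarrow> 'b::complex_inner.
      bounded_linear f \<and> (\<forall>c x. f (c *\<^sub>C x) = c *\<^sub>C f x)}"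
  morphisms bop_apply Bop
proof
  show "(\<lambda>x. 0) \<in> {f :: 'a \<Rightarrow> 'b. bounded_linear f \<and> (\<forall>c x. f (c *\<^sub>C x) = c *\<^sub>C f x)}"
    by simp
qed

setup_lifting type_definition_bop

lemma scaleC_scaleR: "c *\<^sub>C r *\<^sub>R x = r *\<^sub>R c *\<^sub>C (x :: 'a::complex_vector)"
  by (simp add: scaleC_of_real[symmetric] scaleC_scaleC mult.commute)

lemma bounded_linear_scaleC: "bounded_linear (\<lambda>x :: 'a::complex_inner. c *\<^sub>C x)"
proof -
  have n: "norm (c *\<^sub>C x) = cmod c * norm x" for x :: 'a
  proof -
    have s: "cinner x (c *\<^sub>C x) = cnj c * cinner x x"
      by (metis cinner_commute cinner_scaleC_left complex_cnj_mult)
    have im: "Im (cinner x x) = 0"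
      using arg_cong[OF cinner_commute[of x x], of Im] by simp
    have "(c *\<^sub>C x) \<bullet> (c *\<^sub>C x) = Re (c * (cnj c * cinner x x))"
      by (simp add: Re_cinner[symmetric] cinner_scaleC_left s)
    also have "\<dots> = Re (complex_of_real ((cmod c)\<^sup>2) * cinner x x)"
      by (simp add: complex_norm_square mult.assoc del: of_real_power)
    also have "\<dots> = (cmod c)\<^sup>2 * (x \<bullet> x)"
      by (simp add: Re_cinner im del: of_real_power)
    finally show ?thesis
      by (simp add: norm_eq_sqrt_inner real_sqrt_mult)
  qed
  show ?thesis
    by (rule bounded_linear_intro[where K = "cmod c"])
      (simp_all add: scaleC_add_right scaleC_scaleR n mult.commute)
qed

instantiation bop :: (complex_inner, complex_inner) complex_vector
begin

lift_definition zero_bop :: "('a, 'b) bop" is "\<lambda>x. 0"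
  by simp

lift_definition plus_bop :: "('a, 'b) bop \<Rightarrow> ('a, 'b) bop \<Rightarrow> ('a, 'b) bop"
  is "\<lambda>f g x. f x + g x"
  by (auto intro: bounded_linear_add simp: scaleC_add_right)

lift_definition uminus_bop :: "('a, 'b) bop \<Rightarrow> ('a, 'b) bop"
  is "\<lambda>f x. - f x"
  by (auto intro: bounded_linear_minus simp: complex_vector.scale_minus_right)

lift_definition minus_bop :: "('a, 'b) bop \<Rightarrow> ('a, 'b) bop \<Rightarrow> ('a, 'b) bop"
  is "\<lambda>f g x. f x - g x"
  by (auto intro: bounded_linear_sub simp: complex_vector.scale_right_diff_distrib)

lift_definition scaleC_bop :: "complex \<Rightarrow> ('a, 'b) bop \<Rightarrow> ('a, 'b) bop"
  is "\<lambda>c f x. c *\<^sub>C f x"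
  by (auto intro: bounded_linear_compose[OF bounded_linear_scaleC]
      simp: scaleC_scaleC mult.commute)

lift_definition scaleR_bop :: "real \<Rightarrow> ('a, 'b) bop \<Rightarrow> ('a, 'b) bop"
  is "\<lambda>r f x. r *\<^sub>R f x"
  by (auto intro: bounded_linear_const_scaleR simp: scaleC_scaleR)

instance
  by standard (transfer; auto simp: fun_eq_iff algebra_simps scaleC_add_right scaleC_add_left
      scaleC_scaleC scaleC_of_real)+

end

lift_definition bop_compose ::
    "('b::complex_inner, 'c::complex_inner) bop \<Rightarrow> ('a::complex_inner, 'b) bop \<Rightarrow> ('a, 'c) bop"
    (infixl \<open>o\<^sub>C\<close> 70)
  is "\<lambda>f g x. f (g x)"
  by (auto intro: bounded_linear_compose)

definition adj :: "('a::complex_hilbert, 'b::complex_hilbert) bop \<Rightarrow> ('b, 'a) bop" where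
  "adj T = (THE S. \<forall>x y. cinner (bop_apply T x) y = cinner x (bop_apply S y))"

definition op_mult ::
    "('b::complex_inner, 'c::complex_inner) bop set \<Rightarrow> ('a::complex_inner, 'b) bop set
      \<Rightarrow> ('a, 'c) bop set"
    (infixl \<open>\<odot>\<close> 70) where
  "\<X> \<odot> \<Y> = {X o\<^sub>C Y | X Y. X \<in> \<X> \<and> Y \<in> \<Y>}"


section \<open>The weak-* topology\<close>

text \<open>The weak-* topology of \<open>B(H, K)\<close> is that of the duality with the trace class operators
  \<open>K \<rightarrow> H\<close> under \<open>(T, S) \<mapsto> tr (T S)\<close>. The trace class operators are exactly the sums of rank one
  operators \<open>S = (\<Sum>n. \<langle>_, y n\<rangle> x n)\<close> with \<open>x\<close>, \<open>y\<close> square summable, and for such \<open>S\<close> the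
  trace of \<open>T S\<close> is the series below.\<close>

definition trace_functional ::
    "(nat \<Rightarrow> 'a) \<Rightarrow> (nat \<Rightarrow> 'b) \<Rightarrow> ('a::complex_hilbert, 'b::complex_hilbert) bop \<Rightarrow> complex" where
  "trace_functional x y T = (\<Sum>n. cinner (bop_apply T (x n)) (y n))"

definition weak_star :: "('a::complex_hilbert, 'b::complex_hilbert) bop topology" where
  "weak_star = topology_generated_by
     {trace_functional x y -` G | x y G.
        summable (\<lambda>n. (norm (x n))\<^sup>2) \<and> summable (\<lambda>n. (norm (y n))\<^sup>2) \<and> open G}"

definition wspan ::
    "('a::complex_hilbert, 'b::complex_hilbert) bop set \<Rightarrow> ('a, 'b) bop set" where
  "wspan \<X> = weak_star closure_of cspan \<X>"


section \<open>Operator algebras and their equivalences\<close>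

definition operator_algebra :: "('a::complex_hilbert, 'a) bop set \<Rightarrow> bool" where
  "operator_algebra \<A> \<longleftrightarrow> csubspace \<A> \<and> \<A> \<odot> \<A> \<subseteq> \<A>"

definition TRO :: "('a::complex_hilbert, 'b::complex_hilbert) bop set \<Rightarrow> bool" where
  "TRO \<M> \<longleftrightarrow> csubspace \<M> \<and> \<M> \<odot> adj ` \<M> \<odot> \<M> \<subseteq> \<M>"

definition TRO_equivalent ::
    "('a::complex_hilbert, 'a) bop set \<Rightarrow> ('b::complex_hilbert, 'b) bop set \<Rightarrow> bool" where
  "TRO_equivalent \<A> \<B> \<longleftrightarrow>
     (\<exists>\<M> :: ('a, 'b) bop set. TRO \<M> \<and>
        \<A> = wspan (adj ` \<M> \<odot> \<B> \<odot> \<M>) \<and> \<B> = wspan (\<M> \<odot> \<A> \<odot> adj ` \<M>))"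

definition spatially_Morita_equivalent ::
    "('a::complex_hilbert, 'a) bop set \<Rightarrow> ('b::complex_hilbert, 'b) bop set \<Rightarrow> bool" where
  "spatially_Morita_equivalent \<A> \<B> \<longleftrightarrow>
     (\<exists>(\<U> :: ('a, 'b) bop set) (\<V> :: ('b, 'a) bop set).
        csubspace \<U> \<and> csubspace \<V> \<and>
        \<B> \<odot> \<U> \<odot> \<A> \<subseteq> \<U> \<and> \<A> \<odot> \<V> \<odot> \<B> \<subseteq> \<V> \<and>
        wspan (\<V> \<odot> \<U>) = \<A> \<and> wspan (\<U> \<odot> \<V>) = \<B>)"

end

theory Submission imports Defs begin

text \<open>Let \<open>\<M>\<close> implement the TRO equivalence. Neither algebra need be unital, and \<open>\<B>\<B>\<close> need not
  generate \<open>\<B>\<close>, so the obvious pair \<open>\<B>\<M>\<close>, \<open>\<M>\<^sup>*\<B>\<close> may be too small. Adjoining \<open>\<M>\<close> to one side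
  repairs this: let \<open>\<U>\<close> and \<open>\<V>\<close> be the weak-* closed spans of \<open>\<M> \<union> \<B>\<M>\<close> and of \<open>\<M>\<^sup>*\<B>\<close>. As
  \<open>\<B>\<close> is generated by \<open>\<M>\<A>\<M>\<^sup>*\<close> and \<open>\<M>\<M>\<^sup>*\<M> \<subseteq> \<M>\<close>, the algebra \<open>\<B>\<close> is a bimodule over \<open>\<M>\<M>\<^sup>*\<close>; all
  required inclusions follow on generators, and pass to the closed spans because multiplication is
  separately weak-* continuous.\<close>

section \<open>Adjoints\<close>

lemma inner_eqI:
  assumes "\<And>x. x \<bullet> v = x \<bullet> w"
  shows "v = w"
  using assms[of "v - w"] by (metis inner_diff_right inner_eq_zero_iff right_minus_eq)

text \<open>Since Re (i z) = - Im z, the real inner products at a vector and at its multiple by i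
  determine the complex one. This lifts real adjoint identities to complex ones.\<close>

lemma cinner_eqI:
  fixes x z :: "'a::complex_inner" and x' y :: "'b::complex_inner"
  assumes "x' \<bullet> y = x \<bullet> z" and "(\<i> *\<^sub>C x') \<bullet> y = (\<i> *\<^sub>C x) \<bullet> z"
  shows "cinner x' y = cinner x z"
proof (rule complex_eqI)
  show "Re (cinner x' y) = Re (cinner x z)"
    using assms(1) by (simp add: Re_cinner)
  have "Re (\<i> * cinner x' y) = Re (\<i> * cinner x z)"
    using assms(2) by (simp only: Re_cinner[symmetric] cinner_scaleC_left)
  then show "Im (cinner x' y) = Im (cinner x z)"
    by simp
qed

lemma cinner_scaleC_right: "cinner x (c *\<^sub>C y) = cnj c * cinner x y"
  by (metis cinner_commute cinner_scaleC_left complex_cnj_mult)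

text \<open>The representing vector is the minimiser of \<open>\<lambda>x. \<parallel>x\<parallel>\<^sup>2 - 2 f x\<close>; by the parallelogram law every
  minimising sequence is Cauchy.\<close>

lemma riesz_representation:
  fixes f :: "'a::{real_inner, complete_space} \<Rightarrow> real"
  assumes f: "bounded_linear f"
  obtains z where "\<And>x. f x = x \<bullet> z"
proof -
  interpret f: bounded_linear f by (rule f)
  obtain K where K: "\<And>x. norm (f x) \<le> norm x * K"
    using f.bounded by blast
  define J where "J x = x \<bullet> x - 2 * f x" for x
  have lower: "- K\<^sup>2 \<le> J x" for x
  proof -
    have "f x \<le> norm x * K" using K[of x] by (simp add: abs_le_iff)
    \<comment> \<open>Completing the square: \<open>J x\<close> is at least
      \<open>(norm x - K)\<^sup>2 - K\<^sup>2\<close>.\<close>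
    moreover have "0 \<le> (norm x - K)\<^sup>2" by simp
    ultimately show ?thesis
      by (simp add: J_def power2_diff dot_square_norm algebra_simps)
  qed
  define m where "m = (INF x. J x)"
  have bdd: "bdd_below (range J)" using lower by (intro bdd_belowI[of _ "- K\<^sup>2"]) auto
  have m_le: "m \<le> J x" for x
    unfolding m_def by (rule cINF_lower[OF bdd]) simp
  have "\<exists>x. J x < m + 1 / Suc n" for n
  proof -
    have "Inf (range J) < m + 1 / Suc n" by (simp add: m_def)
    then show ?thesis using cInf_lessD[of "range J"] by blast
  qed
  then obtain u where u: "\<And>n. J (u n) < m + 1 / Suc n" by metis
  have par: "(norm (x - y))\<^sup>2 \<le> 2 * (J x - m) + 2 * (J y - m)" for x y
  proof -
    \<comment> \<open>The linear terms of \<open>J\<close> cancel here, leaving the parallelogram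
      law; \<open>m\<close> then bounds \<open>J\<close> at the midpoint from below.\<close>
    have "(norm (x - y))\<^sup>2 = 2 * J x + 2 * J y - 4 * J ((1/2) *\<^sub>R (x + y))"
      by (simp add: J_def dot_square_norm[symmetric] inner_simps inner_commute f.add f.diff f.scaleR
          field_simps)
    with m_le[of "(1/2) *\<^sub>R (x + y)"] show ?thesis by simp
  qed
  have "Cauchy u"
  proof (rule metric_CauchyI)
    fix e :: real assume "0 < e"
    then obtain N where N: "1 / Suc N < e\<^sup>2 / 4"
      using reals_Archimedean[of "e\<^sup>2 / 4"] by (auto simp: inverse_eq_divide)
    have small: "J (u n) - m < e\<^sup>2 / 4" if "N \<le> n" for n
    proof -
      have "1 / Suc n \<le> 1 / Suc N" using that by (simp add: frac_le)
      with u[of n] N show ?thesis by linarith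
    qed
    show "\<exists>M. \<forall>i\<ge>M. \<forall>j\<ge>M. dist (u i) (u j) < e"
    proof (intro exI allI impI)
      fix i j assume ij: "N \<le> i" "N \<le> j"
      have "(norm (u i - u j))\<^sup>2 \<le> 2 * (J (u i) - m) + 2 * (J (u j) - m)" by (rule par)
      also have "\<dots> < 2 * (e\<^sup>2 / 4) + 2 * (e\<^sup>2 / 4)"
        using small[OF ij(1)] small[OF ij(2)] by (intro add_strict_mono mult_strict_left_mono) auto
      finally have "(norm (u i - u j))\<^sup>2 < e\<^sup>2" by simp
      then show "dist (u i) (u j) < e"
        using \<open>0 < e\<close> by (simp add: dist_norm power_less_imp_less_base)
    qed
  qed
  then obtain z where z: "u \<longlonglongrightarrow> z"
    using Cauchy_convergent_iff convergent_def by blast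
  have "(\<lambda>n. J (u n)) \<longlonglongrightarrow> J z"
    unfolding J_def by (intro tendsto_intros z f.tendsto)
  moreover have "(\<lambda>n. m + 1 / Suc n) \<longlonglongrightarrow> m + 0"
    by (intro tendsto_intros lim_inverse_n'[THEN LIMSEQ_Suc])
  ultimately have "J z \<le> m + 0"
    by (rule LIMSEQ_le) (use u less_imp_le in blast)
  then have Jz: "J z \<le> m" by simp
  have "f h = h \<bullet> z" for h
  proof -
    \<comment> \<open>Half the derivative of \<open>J (z + t *\<^sub>R h)\<close> at t = 0, which
      must vanish at a minimiser.\<close>
    define c where "c = z \<bullet> h - f h"
    have quad: "0 \<le> 2 * t * c + t\<^sup>2 * (h \<bullet> h)" for t :: real
    proof -
      have "J (z + t *\<^sub>R h) = J z + 2 * t * c + t\<^sup>2 * (h \<bullet> h)"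
        by (simp add: J_def c_def inner_simps inner_commute f.add f.scaleR power2_eq_square
            algebra_simps)
      with m_le[of "z + t *\<^sub>R h"] Jz show ?thesis by linarith
    qed
    have "c = 0"
    proof (rule ccontr)
      assume "c \<noteq> 0"
      \<comment> \<open>The optimal parameter would be - c / (h . h); adding 1 keeps the denominator
        positive even for h = 0.\<close>
      define s where "s = h \<bullet> h + 1"
      have s: "0 < s" "h \<bullet> h < s" by (simp_all add: s_def add_nonneg_pos)
      have "0 \<le> 2 * (- (c / s)) * c + (- (c / s))\<^sup>2 * (h \<bullet> h)" by (rule quad)
      also have "\<dots> \<le> 2 * (- (c / s)) * c + (- (c / s))\<^sup>2 * s"
        using s by (intro add_left_mono mult_left_mono) auto
      also have "\<dots> = - (c\<^sup>2 / s)" using s by (simp add: field_simps power2_eq_square)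
      also have "\<dots> < 0" using s \<open>c \<noteq> 0\<close> by simp
      finally show False by simp
    qed
    then show ?thesis by (simp add: c_def inner_commute)
  qed
  then show ?thesis by (rule that)
qed

section \<open>Adjoints and composition of bounded operators\<close>

lemma bounded_linear_bop_apply: "bounded_linear (bop_apply T)"
  and bop_apply_scaleC: "bop_apply T (c *\<^sub>C x) = c *\<^sub>C bop_apply T x"
  using bop_apply[of T] by auto

lemma bop_eqI: "(\<And>x. bop_apply S x = bop_apply T x) \<Longrightarrow> S = T"
  by (simp add: bop_apply_inject[symmetric] fun_eq_iff)

text \<open>Riesz representation of the real functionals x -> T x . y yields a real adjoint. Complex
  linearity of \<open>T\<close> makes it an adjoint for \<open>cinner\<close>, from which its own
  complex linearity follows.\<close>

lemma ex_adjoint: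
  fixes T :: "('a::complex_hilbert, 'b::complex_hilbert) bop"
  shows "\<exists>S. \<forall>x y. cinner (bop_apply T x) y = cinner x (bop_apply S y)"
proof -
  interpret T: bounded_linear "bop_apply T" by (rule bounded_linear_bop_apply)
  have "\<exists>z. \<forall>x. bop_apply T x \<bullet> y = x \<bullet> z" for y
  proof -
    have "bounded_linear (\<lambda>x. bop_apply T x \<bullet> y)"
      by (rule bounded_linear_inner_left_comp[OF bounded_linear_bop_apply])
    then show ?thesis by (rule riesz_representation) blast
  qed
  then obtain S where S: "\<And>x y. bop_apply T x \<bullet> y = x \<bullet> S y" by metis
  have C: "cinner (bop_apply T x) y = cinner x (S y)" for x y
    by (rule cinner_eqI) (simp_all add: S flip: bop_apply_scaleC)
  obtain K where "0 < K" and K: "\<And>x. norm (bop_apply T x) \<le> norm x * K"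
    using T.pos_bounded by blast
  have lin: "S (x + y) = S x + S y" "S (r *\<^sub>R x) = r *\<^sub>R S x" for x y r
    by (rule inner_eqI; simp add: S[symmetric] inner_simps)+
  have bd: "norm (S y) \<le> norm y * K" for y
  proof (cases "S y = 0")
    case True
    then show ?thesis using \<open>0 < K\<close> by simp
  next
    case False
    \<comment> \<open>The adjoint identity at x = S y; one factor \<open>norm (S y)\<close> is
      cancelled at the end.\<close>
    have "norm (S y) * norm (S y) = bop_apply T (S y) \<bullet> y"
      by (simp add: S dot_square_norm power2_eq_square)
    also have "\<dots> \<le> norm (bop_apply T (S y)) * norm y" by (rule norm_cauchy_schwarz)
    also have "\<dots> \<le> (norm (S y) * K) * norm y" by (intro mult_right_mono K) simp
    finally have "norm (S y) * norm (S y) \<le> norm (S y) * (norm y * K)" by (simp add: mult_ac)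
    then show ?thesis using False by simp
  qed
  have "bounded_linear S"
    by (rule bounded_linear_intro[where K = K]) (simp_all add: lin bd)
  moreover have "S (c *\<^sub>C y) = c *\<^sub>C S y" for c y
  proof (rule inner_eqI)
    fix x
    have "cinner x (S (c *\<^sub>C y)) = cinner x (c *\<^sub>C S y)"
      unfolding cinner_scaleC_right C[symmetric] ..
    then show "x \<bullet> S (c *\<^sub>C y) = x \<bullet> (c *\<^sub>C S y)" by (metis Re_cinner)
  qed
  ultimately have "bop_apply (Bop S) = S" by (simp add: Bop_inverse)
  with C show ?thesis by metis
qed

lemma adj_eqI:
  fixes T :: "('a::complex_hilbert, 'b::complex_hilbert) bop"
  assumes "\<And>x y. cinner (bop_apply T x) y = cinner x (bop_apply S y)"
  shows "adj T = S"
  unfolding adj_def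
proof (rule the_equality)
  fix R assume R: "\<forall>x y. cinner (bop_apply T x) y = cinner x (bop_apply R y)"
  show "R = S"
    by (rule bop_eqI, rule inner_eqI) (metis R assms Re_cinner)
qed (use assms in blast)

lemma cinner_adj: "cinner (bop_apply T x) y = cinner x (bop_apply (adj T) y)"
  using ex_adjoint[of T] adj_eqI[of T] by blast

lemma adj_adj: "adj (adj T) = T"
  by (rule adj_eqI) (metis cinner_adj cinner_commute)

lemma bop_compose_assoc: "(R o\<^sub>C S) o\<^sub>C T = R o\<^sub>C (S o\<^sub>C T)"
  by transfer simp

lemma adj_compose: "adj (S o\<^sub>C T) = adj T o\<^sub>C adj S"
  by (rule adj_eqI) (simp add: bop_compose.rep_eq cinner_adj)

text \<open>Makes one-sided multiplications instances of the two-sided maps T -> P T Q, for which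
  continuity and induction are proved.\<close>

definition bop_id :: "('a::complex_inner, 'a) bop" where "bop_id = Bop (\<lambda>x. x)"

lemma bop_apply_bop_id [simp]: "bop_apply bop_id x = x"
  unfolding bop_id_def by (subst Bop_inverse) auto

lemma bop_id_compose [simp]: "bop_id o\<^sub>C T = T" "T o\<^sub>C bop_id = T"
  by (auto intro!: bop_eqI simp: bop_compose.rep_eq)

section \<open>Weak-* continuity\<close>

text \<open>A generated topology lives on the union of its generators; the functional of the zero
  sequences with \<open>G = UNIV\<close> already contributes everything.\<close>

lemma topspace_weak_star [simp]: "topspace weak_star = UNIV"
proof -
  have "UNIV = trace_functional (\<lambda>n. 0) (\<lambda>n. 0) -` UNIV" by simp
  then show ?thesis
    unfolding weak_star_def topology_generated_by_topspace
    by (intro equalityI subset_UNIV Union_upper CollectI exI[of _ "\<lambda>n. 0"] exI[of _ UNIV]) simp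
qed

text \<open>Only subbasic sets need checking, and their preimages are again subbasic. The constant
  \<open>c\<close> admits affine maps such as translations.\<close>

lemma continuous_map_weak_starI:
  fixes F :: "('a::complex_hilbert, 'b::complex_hilbert) bop \<Rightarrow>
    ('c::complex_hilbert, 'd::complex_hilbert) bop"
  assumes "\<And>x y. summable (\<lambda>n. (norm (x n))\<^sup>2) \<Longrightarrow> summable (\<lambda>n. (norm (y n))\<^sup>2) \<Longrightarrow>
    \<exists>x' y' c. summable (\<lambda>n. (norm (x' n))\<^sup>2) \<and> summable (\<lambda>n. (norm (y' n))\<^sup>2) \<and>
      (\<forall>T. trace_functional x y (F T) = c + trace_functional x' y' T)"
  shows "continuous_map weak_star weak_star F"
proof -
  have "openin weak_star (F -` (trace_functional x y -` G))"
    if x: "summable (\<lambda>n. (norm (x n))\<^sup>2)" and y: "summable (\<lambda>n. (norm (y n))\<^sup>2)" and G: "open G"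
    for x y G
  proof -
    obtain x' y' c where *: "summable (\<lambda>n. (norm (x' n))\<^sup>2)" "summable (\<lambda>n. (norm (y' n))\<^sup>2)"
      and eq: "\<And>T. trace_functional x y (F T) = c + trace_functional x' y' T"
      using assms[OF x y] by blast
    have "open ((\<lambda>z. c + z) -` G)"
      by (intro open_vimage[OF G] continuous_intros)
    moreover have "F -` (trace_functional x y -` G) = trace_functional x' y' -` ((\<lambda>z. c + z) -` G)"
      by (auto simp: eq)
    ultimately show ?thesis
      unfolding weak_star_def using * by (intro topology_generated_by_Basis) blast
  qed
  moreover have "\<Union> {trace_functional x y -` G | (x :: nat \<Rightarrow> 'c) (y :: nat \<Rightarrow> 'd) G.
        summable (\<lambda>n. (norm (x n))\<^sup>2) \<and> summable (\<lambda>n. (norm (y n))\<^sup>2) \<and> open G} = UNIV"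
    using topspace_weak_star[where ?'a = 'c and ?'b = 'd]
    unfolding weak_star_def topology_generated_by_topspace .
  ultimately show ?thesis
    by (subst (2) weak_star_def) (auto simp: continuous_on_generated_topo_iff)
qed

lemma summable_norm_bop_apply:
  assumes "summable (\<lambda>n. (norm (x n))\<^sup>2)"
  shows "summable (\<lambda>n. (norm (bop_apply T (x n)))\<^sup>2)"
proof -
  obtain K where K: "\<And>x. norm (bop_apply T x) \<le> norm x * K"
    using bounded_linear.bounded[OF bounded_linear_bop_apply] by blast
  have "(norm (bop_apply T (x n)))\<^sup>2 \<le> K\<^sup>2 * (norm (x n))\<^sup>2" for n
    using power_mono[OF K[of "x n"], of 2] by (simp add: power_mult_distrib mult.commute)
  then show ?thesis
    by (intro summable_comparison_test'[OF summable_mult[OF assms, of "K\<^sup>2"]]) simp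
qed

text \<open>A crude bound that suffices for comparison tests: real and imaginary parts are real
  inner products with x and, up to sign, i x, two vectors of equal norm.\<close>

lemma cmod_cinner_le: "cmod (cinner x y) \<le> (norm x)\<^sup>2 + (norm y)\<^sup>2"
  for x y :: "'a::complex_inner"
proof -
  have ab: "\<bar>v \<bullet> y\<bar> \<le> ((norm v)\<^sup>2 + (norm y)\<^sup>2) / 2" for v :: 'a
    using Cauchy_Schwarz_ineq2[of v y] sum_squares_bound[of "norm v" "norm y"] by simp
  have "(\<i> *\<^sub>C x) \<bullet> (\<i> *\<^sub>C x) = Re (\<i> * (cnj \<i> * cinner x x))"
    by (simp only: Re_cinner[symmetric] cinner_scaleC_left cinner_scaleC_right mult.left_commute)
  then have "norm (\<i> *\<^sub>C x) = norm x"
    by (simp add: Re_cinner norm_eq_sqrt_inner)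
  moreover have "\<bar>Im (cinner x y)\<bar> = \<bar>(\<i> *\<^sub>C x) \<bullet> y\<bar>"
    by (simp add: Re_cinner[symmetric] cinner_scaleC_left)
  ultimately show ?thesis
    using cmod_le[of "cinner x y"] ab[of x] ab[of "\<i> *\<^sub>C x"] by (simp add: Re_cinner)
qed

lemma summable_trace:
  assumes "summable (\<lambda>n. (norm (x n))\<^sup>2)" and "summable (\<lambda>n. (norm (y n))\<^sup>2)"
  shows "summable (\<lambda>n. cinner (bop_apply T (x n)) (y n))"
  by (rule summable_comparison_test'[OF summable_add[OF summable_norm_bop_apply[OF assms(1), of T] assms(2)]])
    (rule cmod_cinner_le)

text \<open>Move \<open>S\<close> onto the first sequence and the adjoint of \<open>R\<close> onto
  the second; bounded operators preserve square summability.\<close>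

lemma continuous_map_weak_star_compose:
  fixes S :: "('a::complex_hilbert, 'b::complex_hilbert) bop"
    and R :: "('c::complex_hilbert, 'd::complex_hilbert) bop"
  shows "continuous_map weak_star weak_star (\<lambda>T. R o\<^sub>C T o\<^sub>C S)"
proof (rule continuous_map_weak_starI)
  fix x :: "nat \<Rightarrow> 'a" and y :: "nat \<Rightarrow> 'd"
  assume "summable (\<lambda>n. (norm (x n))\<^sup>2)" "summable (\<lambda>n. (norm (y n))\<^sup>2)"
  then show "\<exists>x' y' c. summable (\<lambda>n. (norm (x' n))\<^sup>2) \<and> summable (\<lambda>n. (norm (y' n))\<^sup>2) \<and>
      (\<forall>T. trace_functional x y (R o\<^sub>C T o\<^sub>C S) = c + trace_functional x' y' T)"
    by (intro exI[of _ "\<lambda>n. bop_apply S (x n)"] exI[of _ "\<lambda>n. bop_apply (adj R) (y n)"] exI[of _ 0])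
      (simp add: summable_norm_bop_apply trace_functional_def bop_compose.rep_eq cinner_adj)
qed

lemma continuous_map_weak_star_add:
  fixes S :: "('a::complex_hilbert, 'b::complex_hilbert) bop"
  shows "continuous_map weak_star weak_star (\<lambda>T. S + T)"
proof (rule continuous_map_weak_starI)
  fix x :: "nat \<Rightarrow> 'a" and y :: "nat \<Rightarrow> 'b"
  assume xy: "summable (\<lambda>n. (norm (x n))\<^sup>2)" "summable (\<lambda>n. (norm (y n))\<^sup>2)"
  then have "trace_functional x y (S + T) = trace_functional x y S + trace_functional x y T" for T
    unfolding trace_functional_def
    by (simp add: suminf_add summable_trace plus_bop.rep_eq cinner_add_left)
  with xy show "\<exists>x' y' c. summable (\<lambda>n. (norm (x' n))\<^sup>2) \<and> summable (\<lambda>n. (norm (y' n))\<^sup>2) \<and>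
      (\<forall>T. trace_functional x y (S + T) = c + trace_functional x' y' T)" by blast
qed

text \<open>Scaling is left composition with a multiple of the identity.\<close>

lemma continuous_map_weak_star_scaleC:
  "continuous_map weak_star weak_star (\<lambda>T :: ('a::complex_hilbert, 'b::complex_hilbert) bop. c *\<^sub>C T)"
proof -
  define I where "I = Bop (\<lambda>x :: 'b. c *\<^sub>C x)"
  have "bop_apply I x = c *\<^sub>C x" for x
    unfolding I_def
    by (subst Bop_inverse) (auto simp: bounded_linear_scaleC scaleC_scaleC mult.commute)
  then have "c *\<^sub>C T = I o\<^sub>C T" for T :: "('a, 'b) bop"
    by (intro bop_eqI) (simp add: bop_compose.rep_eq scaleC_bop.rep_eq)
  then show ?thesis using continuous_map_weak_star_compose[of I bop_id] by simp
qed

lemma closedin_vimage_weak_star: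
  "continuous_map weak_star weak_star F \<Longrightarrow> closedin weak_star S \<Longrightarrow> closedin weak_star (F -` S)"
  using closedin_continuous_map_preimage[of weak_star weak_star F S] by (simp add: vimage_def)

section \<open>Weak-* closed spans\<close>

lemma closedin_wspan: "closedin weak_star (wspan X)"
  by (simp add: wspan_def)

lemma cspan_subset_wspan: "cspan X \<subseteq> wspan X"
  unfolding wspan_def by (rule closure_of_subset) simp

lemma wspan_base: "x \<in> X \<Longrightarrow> x \<in> wspan X"
  using cspan_subset_wspan complex_vector.span_base by blast

lemma wspan_minimal: "X \<subseteq> S \<Longrightarrow> csubspace S \<Longrightarrow> closedin weak_star S \<Longrightarrow> wspan X \<subseteq> S"
  unfolding wspan_def by (intro closure_of_minimal complex_vector.span_minimal)

lemma wspan_continuous_image: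
  assumes "continuous_map weak_star weak_star F" and "closedin weak_star S"
    and "\<And>T. T \<in> cspan X \<Longrightarrow> F T \<in> S" and "T \<in> wspan X"
  shows "F T \<in> S"
proof -
  have "wspan X \<subseteq> F -` S"
    unfolding wspan_def
    by (rule closure_of_minimal[OF _ closedin_vimage_weak_star[OF assms(1,2)]]) (use assms(3) in auto)
  with assms(4) show ?thesis by blast
qed

lemma csubspace_wspan: "csubspace (wspan X)"
proof (rule complex_vector.subspaceI)
  show "0 \<in> wspan X" using cspan_subset_wspan complex_vector.span_zero by blast
  show "c *\<^sub>C T \<in> wspan X" if "T \<in> wspan X" for c T
    by (rule wspan_continuous_image[OF continuous_map_weak_star_scaleC closedin_wspan _ that])
      (use cspan_subset_wspan complex_vector.span_scale in blast)
  \<comment> \<open>Only translations are known to be continuous, so sums take two passes: first one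
    summand stays in the span, then it too runs through the closure.\<close>
  have *: "T + S \<in> wspan X" if "T \<in> cspan X" "S \<in> wspan X" for S T
    by (rule wspan_continuous_image[OF continuous_map_weak_star_add closedin_wspan _ that(2)])
      (use that(1) cspan_subset_wspan complex_vector.span_add in blast)
  show "S + T \<in> wspan X" if "S \<in> wspan X" "T \<in> wspan X" for S T
    by (rule wspan_continuous_image[OF continuous_map_weak_star_add closedin_wspan _ that(2)])
      (use * that(1) in \<open>simp add: add.commute\<close>)
qed

text \<open>The preimage of \<open>S\<close> under T -> P T Q is a weak-* closed subspace, so
  checking generators is enough. All inductions on generators below rest on this.\<close>

lemma compose_wspan:
  assumes "T \<in> wspan X" and "csubspace S" and "closedin weak_star S"
    and "\<And>T. T \<in> X \<Longrightarrow> P o\<^sub>C T o\<^sub>C Q \<in> S"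
  shows "P o\<^sub>C T o\<^sub>C Q \<in> S"
proof -
  have lin: "P o\<^sub>C 0 o\<^sub>C Q = 0" "P o\<^sub>C (T + T') o\<^sub>C Q = P o\<^sub>C T o\<^sub>C Q + P o\<^sub>C T' o\<^sub>C Q"
    "P o\<^sub>C (c *\<^sub>C T) o\<^sub>C Q = c *\<^sub>C (P o\<^sub>C T o\<^sub>C Q)" for T T' c
    by (auto intro!: bop_eqI simp: bop_compose.rep_eq zero_bop.rep_eq plus_bop.rep_eq scaleC_bop.rep_eq
        bop_apply_scaleC bounded_linear.linear[OF bounded_linear_bop_apply, THEN linear_add]
        bounded_linear.linear[OF bounded_linear_bop_apply, THEN linear_0])
  have "csubspace ((\<lambda>T. P o\<^sub>C T o\<^sub>C Q) -` S)"
    using assms(2) by (auto intro!: complex_vector.subspaceI simp: lin complex_vector.subspace_0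
        complex_vector.subspace_add complex_vector.subspace_scale)
  then have "wspan X \<subseteq> (\<lambda>T. P o\<^sub>C T o\<^sub>C Q) -` S"
    by (intro wspan_minimal closedin_vimage_weak_star continuous_map_weak_star_compose assms(3))
      (use assms(4) in auto)
  with assms(1) show ?thesis by blast
qed

section \<open>The bimodules of a TRO equivalence\<close>

lemma op_multI: "S \<in> X \<Longrightarrow> T \<in> Y \<Longrightarrow> S o\<^sub>C T \<in> X \<odot> Y"
  unfolding op_mult_def by blast

lemma op_multE:
  assumes "R \<in> X \<odot> Y"
  obtains S T where "R = S o\<^sub>C T" "S \<in> X" "T \<in> Y"
  using assms unfolding op_mult_def by blast

theorem theorem4p5:
  fixes \<A> :: "('a::complex_hilbert, 'a) bop set"
    and \<B> :: "('b::complex_hilbert, 'b) bop set"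
  assumes "operator_algebra \<A>" and "closedin weak_star \<A>"
    and "operator_algebra \<B>" and "closedin weak_star \<B>"
    and "TRO_equivalent \<A> \<B>"
  shows "spatially_Morita_equivalent \<A> \<B>"
proof -
  obtain \<M> :: "('a, 'b) bop set" where TRO: "TRO \<M>"
    and A: "\<A> = wspan (adj ` \<M> \<odot> \<B> \<odot> \<M>)" and B: "\<B> = wspan (\<M> \<odot> \<A> \<odot> adj ` \<M>)"
    using assms(5) unfolding TRO_equivalent_def by blast
  have subA: "csubspace \<A>" and subB: "csubspace \<B>"
    using assms(1,3) unfolding operator_algebra_def by blast+
  have BB: "b o\<^sub>C b' \<in> \<B>" if "b \<in> \<B>" "b' \<in> \<B>" for b b'
    using assms(3) that op_multI unfolding operator_algebra_def by blast
  have MMM: "m o\<^sub>C (adj n o\<^sub>C k) \<in> \<M>" if "m \<in> \<M>" "n \<in> \<M>" "k \<in> \<M>" for m n k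
  proof -
    have "(m o\<^sub>C adj n) o\<^sub>C k \<in> \<M> \<odot> adj ` \<M> \<odot> \<M>" using that by (intro op_multI imageI)
    then show ?thesis using TRO by (auto simp: TRO_def bop_compose_assoc)
  qed
  have MAM: "m o\<^sub>C (a o\<^sub>C adj n) \<in> \<B>" if "m \<in> \<M>" "a \<in> \<A>" "n \<in> \<M>" for m n a
    unfolding bop_compose_assoc[symmetric]
    by (subst B, intro wspan_base op_multI imageI that)
  have MBM: "adj m o\<^sub>C (b o\<^sub>C n) \<in> \<A>" if "m \<in> \<M>" "b \<in> \<B>" "n \<in> \<M>" for m n b
    unfolding bop_compose_assoc[symmetric]
    by (subst A, intro wspan_base op_multI imageI that)
  \<comment> \<open>The target is an arbitrary closed span because \<open>\<U>\<close>,
    \<open>\<V>\<close> and \<open>wspan (\<U> \<odot> \<V>)\<close> all occur in this role.\<close>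
  have A_induct: "P o\<^sub>C a o\<^sub>C Q \<in> wspan X"
    if "a \<in> \<A>" "\<And>m b n. m \<in> \<M> \<Longrightarrow> b \<in> \<B> \<Longrightarrow> n \<in> \<M> \<Longrightarrow> P o\<^sub>C (adj m o\<^sub>C b o\<^sub>C n) o\<^sub>C Q \<in> wspan X"
    for a P X and Q
    by (rule compose_wspan[OF that(1)[unfolded A] csubspace_wspan closedin_wspan])
      (auto elim!: op_multE intro: that(2))
  have B_induct: "P o\<^sub>C b o\<^sub>C Q \<in> \<B>"
    if "b \<in> \<B>" "\<And>m a n. m \<in> \<M> \<Longrightarrow> a \<in> \<A> \<Longrightarrow> n \<in> \<M> \<Longrightarrow> P o\<^sub>C (m o\<^sub>C a o\<^sub>C adj n) o\<^sub>C Q \<in> \<B>"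
    for b P Q
    by (rule compose_wspan[OF that(1)[unfolded B] subB assms(4)])
      (auto elim!: op_multE intro: that(2))
  have MMB: "m o\<^sub>C (adj n o\<^sub>C b) \<in> \<B>" if "m \<in> \<M>" "n \<in> \<M>" "b \<in> \<B>" for m n b
  proof -
    \<comment> \<open>On a generator k a l* of \<open>\<B>\<close>, the factor m n* k is absorbed
      into \<open>\<M>\<close>.\<close>
    have "(m o\<^sub>C adj n) o\<^sub>C b o\<^sub>C bop_id \<in> \<B>"
    proof (rule B_induct[OF that(3)])
      fix k a l assume *: "k \<in> \<M>" "a \<in> \<A>" "l \<in> \<M>"
      show "m o\<^sub>C adj n o\<^sub>C (k o\<^sub>C a o\<^sub>C adj l) o\<^sub>C bop_id \<in> \<B>"
        using MAM[OF MMM[OF that(1,2) *(1)] *(2,3)] by (simp add: bop_compose_assoc)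
    qed
    then show ?thesis by (simp add: bop_compose_assoc)
  qed
  have BMM: "b o\<^sub>C (m o\<^sub>C adj n) \<in> \<B>" if "b \<in> \<B>" "m \<in> \<M>" "n \<in> \<M>" for m n b
  proof -
    have "bop_id o\<^sub>C b o\<^sub>C (m o\<^sub>C adj n) \<in> \<B>"
    proof (rule B_induct[OF that(1)])
      fix k a l assume *: "k \<in> \<M>" "a \<in> \<A>" "l \<in> \<M>"
      show "bop_id o\<^sub>C (k o\<^sub>C a o\<^sub>C adj l) o\<^sub>C (m o\<^sub>C adj n) \<in> \<B>"
        \<comment> \<open>Here l* m n* is the adjoint of n m* l, which lies in \<open>\<M>\<close>;
          hence the reversed order of the facts.\<close>
        using MAM[OF *(1,2) MMM[OF that(3,2) *(3)]]
        by (simp add: bop_compose_assoc adj_compose adj_adj)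
    qed
    then show ?thesis by simp
  qed
  define \<U> where "\<U> = wspan (\<M> \<union> \<B> \<odot> \<M>)"
  \<comment> \<open>\<open>\<M>\<close> is adjoined on one side only: if \<open>\<V>\<close> also
    contained the adjoints of \<open>\<M>\<close>, then \<open>\<V> \<odot> \<U>\<close> would
    contain M*M, which can fail to lie in \<open>\<A>\<close> (take zero algebras and a nonzero
    TRO).\<close>
  define \<V> where "\<V> = wspan (adj ` \<M> \<odot> \<B>)"
  have M_U: "m \<in> \<U>" if "m \<in> \<M>" for m
    unfolding \<U>_def by (rule wspan_base) (use that in blast)
  have BM_U: "b o\<^sub>C m \<in> \<U>" and MB_V: "adj m o\<^sub>C b \<in> \<V>"
    if "m \<in> \<M>" "b \<in> \<B>" for m b
    unfolding \<U>_def \<V>_def using that by (auto intro: wspan_base op_multI)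
  have U_induct: "P o\<^sub>C u o\<^sub>C Q \<in> S"
    if "u \<in> \<U>" "csubspace S" "closedin weak_star S" "\<And>m. m \<in> \<M> \<Longrightarrow> P o\<^sub>C m o\<^sub>C Q \<in> S"
      "\<And>m b. m \<in> \<M> \<Longrightarrow> b \<in> \<B> \<Longrightarrow> P o\<^sub>C (b o\<^sub>C m) o\<^sub>C Q \<in> S"
    for u and P :: "('b, 'c::complex_hilbert) bop" and Q :: "('d::complex_hilbert, 'a) bop" and S
    by (rule compose_wspan[OF that(1)[unfolded \<U>_def] that(2,3)])
      (auto elim!: op_multE intro: that(4,5))
  have V_induct: "P o\<^sub>C v o\<^sub>C Q \<in> S"
    if "v \<in> \<V>" "csubspace S" "closedin weak_star S"
      "\<And>m b. m \<in> \<M> \<Longrightarrow> b \<in> \<B> \<Longrightarrow> P o\<^sub>C (adj m o\<^sub>C b) o\<^sub>C Q \<in> S"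
    for v and P :: "('a, 'c::complex_hilbert) bop" and Q :: "('d::complex_hilbert, 'b) bop" and S
    by (rule compose_wspan[OF that(1)[unfolded \<V>_def] that(2,3)])
      (auto elim!: op_multE intro: that(4))
  have subU: "csubspace \<U>" "closedin weak_star \<U>" and subV: "csubspace \<V>" "closedin weak_star \<V>"
    unfolding \<U>_def \<V>_def by (rule csubspace_wspan closedin_wspan)+
  have BMA: "(b o\<^sub>C m) o\<^sub>C a \<in> \<U>" if "b \<in> \<B>" "m \<in> \<M>" "a \<in> \<A>" for b m a
  proof -
    have "(b o\<^sub>C m) o\<^sub>C a o\<^sub>C bop_id \<in> \<U>"
      unfolding \<U>_def
    proof (rule A_induct[OF that(3)], fold \<U>_def)
      fix n b' k assume *: "n \<in> \<M>" "b' \<in> \<B>" "k \<in> \<M>"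
      show "(b o\<^sub>C m) o\<^sub>C (adj n o\<^sub>C b' o\<^sub>C k) o\<^sub>C bop_id \<in> \<U>"
        \<comment> \<open>Regroup b m (n* b' k) as (b (m n* b')) k; the bracket is in
          \<open>\<B>\<close> by \<open>MMB\<close> and \<open>BB\<close>.\<close>
        using BM_U[OF *(3) BB[OF that(1) MMB[OF that(2) *(1,2)]]] by (simp add: bop_compose_assoc)
    qed
    then show ?thesis by simp
  qed
  have BUA: "b o\<^sub>C u o\<^sub>C a \<in> \<U>" if "b \<in> \<B>" "u \<in> \<U>" "a \<in> \<A>" for b u a
  proof (rule U_induct[OF that(2) subU])
    fix m b' assume "m \<in> \<M>" "b' \<in> \<B>"
    then show "b o\<^sub>C (b' o\<^sub>C m) o\<^sub>C a \<in> \<U>"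
      using BMA[OF BB[OF that(1)] _ that(3)] by (simp add: bop_compose_assoc)
  qed (rule BMA[OF that(1) _ that(3)])
  have AVB: "a o\<^sub>C v o\<^sub>C b \<in> \<V>" if "a \<in> \<A>" "v \<in> \<V>" "b \<in> \<B>" for a v b
  proof (rule V_induct[OF that(2) subV])
    fix m b' assume m: "m \<in> \<M>" "b' \<in> \<B>"
    have "bop_id o\<^sub>C a o\<^sub>C (adj m o\<^sub>C b' o\<^sub>C b) \<in> \<V>"
      unfolding \<V>_def
    proof (rule A_induct[OF that(1)], fold \<V>_def)
      fix n c k assume *: "n \<in> \<M>" "c \<in> \<B>" "k \<in> \<M>"
      show "bop_id o\<^sub>C (adj n o\<^sub>C c o\<^sub>C k) o\<^sub>C (adj m o\<^sub>C b' o\<^sub>C b) \<in> \<V>"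
        \<comment> \<open>Regroup as n* (c (k m* (b' b))), again with the bracket in
          \<open>\<B>\<close>.\<close>
        using MB_V[OF *(1) BB[OF *(2) MMB[OF *(3) m(1) BB[OF m(2) that(3)]]]]
        by (simp add: bop_compose_assoc)
    qed
    then show "a o\<^sub>C (adj m o\<^sub>C b') o\<^sub>C b \<in> \<V>" by (simp add: bop_compose_assoc)
  qed
  \<comment> \<open>Two nested inductions, one factor at a time, leave m* b m' and m* (b b') m',
    both generators of \<open>\<A>\<close>.\<close>
  have VU: "v o\<^sub>C u \<in> \<A>" if "v \<in> \<V>" "u \<in> \<U>" for v u
  proof -
    have "bop_id o\<^sub>C v o\<^sub>C u \<in> \<A>"
    proof (rule V_induct[OF that(1) subA assms(2)])
      fix m b assume m: "m \<in> \<M>" "b \<in> \<B>"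
      have "(adj m o\<^sub>C b) o\<^sub>C u o\<^sub>C bop_id \<in> \<A>"
        by (rule U_induct[OF that(2) subA assms(2)])
          (use MBM[OF m(1) m(2)] MBM[OF m(1) BB[OF m(2)]] in \<open>simp_all add: bop_compose_assoc\<close>)
      then show "bop_id o\<^sub>C (adj m o\<^sub>C b) o\<^sub>C u \<in> \<A>" by simp
    qed
    then show ?thesis by simp
  qed
  \<comment> \<open>Likewise, the remaining products are m' m* b and b' (m' m* b), in
    \<open>\<B>\<close> by \<open>MMB\<close> and \<open>BB\<close>.\<close>
  have UV: "u o\<^sub>C v \<in> \<B>" if "u \<in> \<U>" "v \<in> \<V>" for u v
  proof -
    have "u o\<^sub>C v o\<^sub>C bop_id \<in> \<B>"
    proof (rule V_induct[OF that(2) subB assms(4)])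
      fix m b assume m: "m \<in> \<M>" "b \<in> \<B>"
      have "bop_id o\<^sub>C u o\<^sub>C (adj m o\<^sub>C b) \<in> \<B>"
        by (rule U_induct[OF that(1) subB assms(4)])
          (use MMB[OF _ m] BB[OF _ MMB[OF _ m]] in \<open>simp_all add: bop_compose_assoc\<close>)
      then show "u o\<^sub>C (adj m o\<^sub>C b) o\<^sub>C bop_id \<in> \<B>" by simp
    qed
    then show ?thesis by simp
  qed
  have "wspan (\<V> \<odot> \<U>) = \<A>"
  proof (rule equalityI)
    show "wspan (\<V> \<odot> \<U>) \<subseteq> \<A>"
      by (rule wspan_minimal[OF _ subA assms(2)]) (auto elim!: op_multE intro: VU)
    show "\<A> \<subseteq> wspan (\<V> \<odot> \<U>)"
      \<comment> \<open>A generator m* b n splits as m* b in \<open>\<V>\<close> times n in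
        \<open>\<U>\<close>; having \<open>\<M>\<close> inside \<open>\<U>\<close> removes any need
        to factor b.\<close>
      by (subst A, rule wspan_minimal[OF _ csubspace_wspan closedin_wspan])
        (auto elim!: op_multE intro!: wspan_base op_multI MB_V M_U)
  qed
  moreover have "wspan (\<U> \<odot> \<V>) = \<B>"
  proof (rule equalityI)
    show "wspan (\<U> \<odot> \<V>) \<subseteq> \<B>"
      by (rule wspan_minimal[OF _ subB assms(4)]) (auto elim!: op_multE intro: UV)
    have "m o\<^sub>C a o\<^sub>C adj n \<in> wspan (\<U> \<odot> \<V>)" if "m \<in> \<M>" "a \<in> \<A>" "n \<in> \<M>" for m a n
    proof (rule A_induct[OF that(2)])
      fix k b l assume *: "k \<in> \<M>" "b \<in> \<B>" "l \<in> \<M>"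
      have "m o\<^sub>C (adj k o\<^sub>C (b o\<^sub>C (l o\<^sub>C adj n))) \<in> \<U> \<odot> \<V>"
        using * that BMM by (intro op_multI M_U MB_V)
      then show "m o\<^sub>C (adj k o\<^sub>C b o\<^sub>C l) o\<^sub>C adj n \<in> wspan (\<U> \<odot> \<V>)"
        by (simp add: wspan_base bop_compose_assoc)
    qed
    then show "\<B> \<subseteq> wspan (\<U> \<odot> \<V>)"
      by (subst B, intro wspan_minimal[OF _ csubspace_wspan closedin_wspan])
        (auto elim!: op_multE)
  qed
  ultimately show ?thesis
    unfolding spatially_Morita_equivalent_def
    by (intro exI[of _ \<U>] exI[of _ \<V>] conjI subU subV)
      (auto elim!: op_multE intro: BUA AVB)
qed

end
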